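(* Let $\mu>0$, $s>0$, and let $\varphi:\mathbb{R}\to\mathbb{R}$ be strictly convex on $\mathbb{R}$, differentiable on $\mathbb{R}\setminus\{\mu\}$, with $\lim_{|x|\to\infty}|\varphi(x)/x|=\infty$, $\varphi(\mu)=0$, and global minimum attained at $\mu$. Let $t<\mu$. Then $$\inf_{\mathbb{P}\in\mathcal{P}(\mu,s,\varphi)}\mathbb{P}(X\ge t)=\frac{\mu-t}{v_2-t},$$ where $v_2>\mu$ is the solution to $$\frac{v_2-\mu}{v_2-t}\varphi(t)+\frac{\mu-t}{v_2-t}\varphi(v_2)=s.$$ The infimum is approached by the two-point distributions in $\mathcal{P}(\mu,s,\varphi)$ whose left support point $v_1<\mu$ tends to $t$ from below ($v_1\uparrow t$).
   Context: $\mathcal{P}(\mu,s,\varphi)$ is the set of all probability distributions $\mathbb{P}$ on $\mathbb{R}$ such that, for $X\sim\mathbb{P}$, $\mathbb{E}_{\mathbb{P}}(X)=\mu$ and $\mathbb{E}_{\mathbb{P}}(\varphi(X))=s$. A two-point distribution is a distribution supported on two points $v_1<\mu<v_2$ with probability masses $w_1,w_2$. *)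

theory Defs
  imports "HOL-Probability.Probability"
begin

definition strictly_convex_on :: "real set \<Rightarrow> (real \<Rightarrow> real) \<Rightarrow> bool" where
  "strictly_convex_on S f \<longleftrightarrow> convex S \<and>
    (\<forall>x\<in>S. \<forall>y\<in>S. \<forall>u>0. \<forall>v>0. x \<noteq> y \<longrightarrow> u + v = 1 \<longrightarrow>
       f (u * x + v * y) < u * f x + v * f y)"

text \<open>The set \<open>\<P>(\<mu>, s, \<phi>)\<close>. The predicate \<^const>\<open>has_bochner_integral\<close> includes
  integrability, so that both expectations are genuinely finite; the bare Bochner integral
  would be \<open>0\<close> for a non-integrable function.\<close>

definition ambiguity_set :: "real \<Rightarrow> real \<Rightarrow> (real \<Rightarrow> real) \<Rightarrow> real measure set" where
  "ambiguity_set \<mu> s \<phi> =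
    {P. real_distribution P \<and> has_bochner_integral P (\<lambda>x. x) \<mu> \<and> has_bochner_integral P \<phi> s}"

definition two_point_distribution ::
    "real \<Rightarrow> real \<Rightarrow> real \<Rightarrow> real \<Rightarrow> real \<Rightarrow> real measure \<Rightarrow> bool" where
  "two_point_distribution \<mu> v\<^sub>1 v\<^sub>2 w\<^sub>1 w\<^sub>2 P \<longleftrightarrow>
    real_distribution P \<and> v\<^sub>1 < \<mu> \<and> \<mu> < v\<^sub>2 \<and> w\<^sub>1 > 0 \<and> w\<^sub>2 > 0 \<and> w\<^sub>1 + w\<^sub>2 = 1 \<and>
    measure P {v\<^sub>1} = w\<^sub>1 \<and> measure P {v\<^sub>2} = w\<^sub>2"

definition two_point_ambiguity_set ::
    "real \<Rightarrow> real \<Rightarrow> (real \<Rightarrow> real) \<Rightarrow> real \<Rightarrow> real measure set" where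
  "two_point_ambiguity_set \<mu> s \<phi> v\<^sub>1 =
    {P \<in> ambiguity_set \<mu> s \<phi>. \<exists>v\<^sub>2 w\<^sub>1 w\<^sub>2. two_point_distribution \<mu> v\<^sub>1 v\<^sub>2 w\<^sub>1 w\<^sub>2 P}"

end

theory Submission
  imports Defs
begin

text \<open>Let \<open>a < \<mu> < b\<close>. The only law on \<open>{a, b}\<close> with mean \<open>\<mu>\<close> has mass
  \<open>(\<mu> - a) / (b - a)\<close> at \<open>b\<close>, and under it the expectation of \<open>\<phi>\<close> is the height at \<open>\<mu>\<close>
  of the chord of \<open>\<phi>\<close> from \<open>a\<close> to \<open>b\<close>. By strict convexity this height strictly increases
  with \<open>b\<close>; it starts from \<open>\<phi> \<mu> = 0\<close> at \<open>b = \<mu>\<close> and is unbounded because \<open>\<phi>\<close> grows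
  superlinearly. So each \<open>a < \<mu>\<close> has exactly one partner \<open>b\<close> for which the height is \<open>s\<close>;
  the partner of \<open>t\<close> is \<open>v\<^sub>2\<close> (\<open>chord_value_attains\<close>, \<open>chord_value_inj\<close>).

  The lower bound is linear programming duality. Let \<open>G x\<close> be the height of \<open>\<phi>\<close> over its
  tangent at \<open>v\<^sub>2\<close>. The function \<open>1 - G x / G t\<close> is concave, has its maximum \<open>1\<close> at \<open>v\<^sub>2\<close>
  and vanishes at \<open>t\<close>, hence lies below the indicator of \<open>{t..}\<close>. It is a combination of
  \<open>1\<close>, \<open>x\<close> and \<open>\<phi> x\<close>, so all laws in the ambiguity set give it the same expectation. That
  number is what the law on \<open>{t, v\<^sub>2}\<close> gives, namely the mass \<open>(\<mu> - t) / (v\<^sub>2 - t)\<close> of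
  \<open>v\<^sub>2\<close> (\<open>ambiguity_set_upper_tail_ge\<close>).

  The law on \<open>{t, v\<^sub>2}\<close> itself does not attain the bound, since its atom \<open>t\<close> is counted in
  \<open>{t..}\<close>. Moving the left atom slightly below \<open>t\<close> removes it from the event, and the
  partner of the left atom cannot drop below \<open>v\<^sub>2\<close> in the limit, so the remaining mass tends
  to the bound (\<open>two_point_upper_tail_tendsto\<close>).\<close>

section \<open>Strict convexity and chords\<close>

text \<open>The height at \<open>m\<close> of the chord of \<open>f\<close> over \<open>[a, b]\<close>, that is, the expectation of \<open>f\<close>
  under the law on \<open>{a, b}\<close> with mean \<open>m\<close>.\<close>

definition chord_value :: "(real \<Rightarrow> real) \<Rightarrow> real \<Rightarrow> real \<Rightarrow> real \<Rightarrow> real" where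
  "chord_value f m a b = (b - m) / (b - a) * f a + (m - a) / (b - a) * f b"

lemma strictly_convex_onD_three_points:
  assumes "strictly_convex_on UNIV f" and "x < y" and "y < z"
  shows "(z - x) * f y < (z - y) * f x + (y - x) * f z"
proof -
  define u v where "u = (z - y) / (z - x)" and "v = (y - x) / (z - x)"
  have pos: "z - x > 0" using assms by simp
  have "u > 0" "v > 0" "u + v = 1"
    using assms by (simp_all add: u_def v_def add_divide_distrib[symmetric])
  then have "f (u * x + v * z) < u * f x + v * f z"
    using assms unfolding strictly_convex_on_def by auto
  moreover have "u * x + v * z = y * (z - x) / (z - x)"
    unfolding u_def v_def times_divide_eq_left add_divide_distrib[symmetric]
    by (rule arg_cong[where f = "\<lambda>w. w / (z - x)"]) (simp add: algebra_simps)
  ultimately have "(z - x) * f y < (z - x) * (u * f x + v * f z)"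
    using pos by simp
  also have "\<dots> = (z - y) * f x + (y - x) * f z"
    using pos by (simp add: u_def v_def distrib_left)
  finally show ?thesis .
qed

lemma strictly_convex_on_imp_convex_on:
  assumes "strictly_convex_on S f"
  shows "convex_on S f"
proof (rule convex_onI)
  show "convex S" using assms by (simp add: strictly_convex_on_def)
next
  fix u x y :: real
  assume "0 < u" "u < 1" "x \<in> S" "y \<in> S"
  moreover from this have "0 < 1 - u" "1 - u + u = 1" by simp_all
  ultimately have "x = y \<or> f ((1 - u) * x + u * y) < (1 - u) * f x + u * f y"
    using assms unfolding strictly_convex_on_def by blast
  then show "f ((1 - u) *\<^sub>R x + u *\<^sub>R y) \<le> (1 - u) * f x + u * f y"
    by (auto simp: algebra_simps)
qed

text \<open>At the midpoint \<open>y\<close> of \<open>x\<close> and \<open>c\<close> the function is not below the tangent but strictly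
  below the chord, so at \<open>x\<close> the chord, and with it \<open>f\<close>, is strictly above the tangent.\<close>

lemma strictly_convex_on_above_tangent:
  assumes f: "strictly_convex_on UNIV f" and d: "(f has_real_derivative d) (at c)"
    and "x \<noteq> c"
  shows "f x > f c + d * (x - c)"
proof -
  define y where "y = (x + c) / 2"
  have tangent: "f z - f c \<ge> d * (z - c)" for z
    using convex_on_imp_above_tangent[OF strictly_convex_on_imp_convex_on[OF f], of c z d]
      d by (auto simp: mult.commute)
  have "u > 0 \<Longrightarrow> v > 0 \<Longrightarrow> u + v = 1 \<Longrightarrow> f (u * x + v * c) < u * f x + v * f c" for u v
    using f \<open>x \<noteq> c\<close> unfolding strictly_convex_on_def by blast
  from this[of "1/2" "1/2"] have "2 * f y < f x + f c" by (simp add: y_def add_divide_distrib)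
  moreover have "y - c = (x - c) / 2" by (simp add: y_def field_simps)
  then have "2 * (d * (y - c)) = d * (x - c)" by simp
  ultimately show ?thesis using tangent[of y] by linarith
qed

text \<open>The chord starts at the fixed point over \<open>a\<close>, so its height at \<open>m\<close> is governed by its
  slope, which increases strictly with the right end point.\<close>

lemma chord_value_strict_mono:
  assumes f: "strictly_convex_on UNIV f" and "a < m" and "m \<le> b" and "b < b'"
  shows "chord_value f m a b < chord_value f m a b'"
proof -
  have alt: "chord_value f m a z = f a + (m - a) * ((f z - f a) / (z - a))" if "z > a" for z
  proof -
    have "(z - m) / (z - a) = 1 - (m - a) / (z - a)" using that by (simp add: field_simps)
    then show ?thesis by (simp add: chord_value_def algebra_simps diff_divide_distrib)
  qed
  have "(b' - a) * f b < (b' - b) * f a + (b - a) * f b'"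
    using strictly_convex_onD_three_points[OF f, of a b b'] assms by simp
  then have "(f b - f a) / (b - a) < (f b' - f a) / (b' - a)"
    using assms by (simp add: frac_less_eq divide_less_eq less_divide_eq) (simp add: field_simps)
  from mult_strict_left_mono[OF this, of "m - a"] show ?thesis using assms by (simp add: alt)
qed

lemma chord_value_less_iff:
  assumes "strictly_convex_on UNIV f" and "a < m" and "m \<le> b" and "m \<le> b'"
  shows "chord_value f m a b < chord_value f m a b' \<longleftrightarrow> b < b'"
  using chord_value_strict_mono[OF assms(1,2)] assms by (metis less_asym linorder_neqE)

lemma chord_value_inj:
  assumes "strictly_convex_on UNIV f" and "a < m" and "m \<le> b" and "m \<le> b'"
    and "chord_value f m a b = chord_value f m a b'"
  shows "b = b'"
  using chord_value_less_iff[OF assms(1-4)] chord_value_less_iff[OF assms(1,2,4,3)] assms(5) by auto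

lemma strictly_convex_on_continuous:
  assumes "strictly_convex_on UNIV (f :: real \<Rightarrow> real)"
  shows "continuous_on UNIV f"
  using convex_on_continuous[of UNIV f] strictly_convex_on_imp_convex_on[OF assms] by simp

text \<open>Intermediate values: the chord through a degenerate right end point \<open>m\<close> has height
  \<open>f m = 0\<close>, and superlinear growth makes the height unbounded as the right end point
  recedes.\<close>

lemma chord_value_attains:
  assumes f: "strictly_convex_on UNIV f" and growth: "filterlim (\<lambda>x. \<bar>f x / x\<bar>) at_top at_infinity"
    and zero: "f m = 0" and nonneg: "\<And>x. 0 \<le> f x" and "a < m" and "0 < s"
  obtains b where "m < b" and "chord_value f m a b = s"
proof -
  \<comment> \<open>Once \<open>B \<ge> \<bar>a\<bar>\<close>, the interval \<open>[a, B]\<close> has length at most \<open>2 * B\<close>; hence the factor \<open>2\<close>.\<close>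
  have "filterlim (\<lambda>x. \<bar>f x / x\<bar>) at_top at_top"
    using growth at_top_le_at_infinity by (rule filterlim_mono[OF _ order_refl])
  then have "\<forall>\<^sub>F x in at_top. \<bar>f x / x\<bar> \<ge> 2 * s / (m - a)"
    by (simp add: filterlim_at_top)
  moreover have "\<forall>\<^sub>F x in at_top. x > max m (max 0 \<bar>a\<bar>)" by (rule eventually_gt_at_top)
  ultimately have "\<forall>\<^sub>F x in at_top. \<bar>f x / x\<bar> \<ge> 2 * s / (m - a) \<and> x > max m (max 0 \<bar>a\<bar>)"
    by eventually_elim auto
  then obtain B where B: "\<bar>f B / B\<bar> \<ge> 2 * s / (m - a)" "B > m" "B > 0" "B > \<bar>a\<bar>"
    by (auto dest: eventually_happens)
  have "2 * s / (m - a) \<le> f B / B" using B nonneg[of B] by simp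
  then have "s \<le> (m - a) * (f B / (2 * B))"
    using \<open>a < m\<close> B by (simp add: field_simps)
  also have "\<dots> \<le> (m - a) * (f B / (B - a))"
    using \<open>a < m\<close> B nonneg[of B] by (intro mult_left_mono divide_left_mono) auto
  also have "\<dots> \<le> chord_value f m a B"
    using \<open>a < m\<close> B nonneg[of a] by (simp add: chord_value_def)
  finally have upper: "s \<le> chord_value f m a B" .
  have lower: "chord_value f m a m = 0" by (simp add: chord_value_def zero)
  have "continuous_on {m..B} (chord_value f m a)"
    unfolding chord_value_def using \<open>a < m\<close>
    by (intro continuous_intros continuous_on_subset[OF strictly_convex_on_continuous[OF f]]) auto
  then obtain b where b: "m \<le> b" "chord_value f m a b = s"
    using IVT'[of "chord_value f m a" m s B] lower upper \<open>0 < s\<close> B by auto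
  moreover have "b \<noteq> m" using b lower \<open>0 < s\<close> by auto
  ultimately have "m < b" by simp
  then show ?thesis using b that by blast
qed

section \<open>Two-point distributions\<close>

text \<open>The two prescribed masses already sum to \<open>1\<close>.\<close>

lemma two_point_distribution_AE:
  assumes P: "two_point_distribution m a b w\<^sub>1 w\<^sub>2 P"
  shows "AE x in P. x = a \<or> x = b"
proof -
  interpret real_distribution P using P by (simp add: two_point_distribution_def)
  have "prob ({a} \<union> {b}) = 1"
    using P by (subst finite_measure_Union) (auto simp: two_point_distribution_def)
  then have "AE x in P. x \<in> {a} \<union> {b}" by (subst prob_eq_1[symmetric]) auto
  then show ?thesis by (simp add: disj_commute)
qed

lemma two_point_distribution_integral:
  fixes f :: "real \<Rightarrow> real"
  assumes P: "two_point_distribution m a b w\<^sub>1 w\<^sub>2 P" and f: "f \<in> borel_measurable borel"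
  shows "integral\<^sup>L P f = w\<^sub>1 * f a + w\<^sub>2 * f b"
proof -
  interpret real_distribution P using P by (simp add: two_point_distribution_def)
  have "a < b" using P by (auto simp: two_point_distribution_def)
  have "integral\<^sup>L P f = (\<integral>x. indicator {a} x * f a + indicator {b} x * f b \<partial>P)"
    using two_point_distribution_AE[OF P] f \<open>a < b\<close>
    by (intro integral_cong_AE) (auto elim!: eventually_mono)
  also have "\<dots> = w\<^sub>1 * f a + w\<^sub>2 * f b"
    using P by (subst Bochner_Integration.integral_add)
      (auto simp: two_point_distribution_def emeasure_eq_measure
        intro!: integrable_mult_left integrable_real_indicator)
  finally show ?thesis .
qed

lemma two_point_distribution_upper_tail:
  assumes P: "two_point_distribution m a b w\<^sub>1 w\<^sub>2 P" and "a < t" and "t \<le> b"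
  shows "measure P {t..} = w\<^sub>2"
proof -
  interpret real_distribution P using P by (simp add: two_point_distribution_def)
  have "prob {t..} = prob {b}"
    using two_point_distribution_AE[OF P] assms(2,3)
    by (intro finite_measure_eq_AE) (auto elim!: eventually_mono)
  then show ?thesis using P by (simp add: two_point_distribution_def)
qed

text \<open>The mean condition determines the masses, and then the moment condition says that the
  chord has height \<open>s\<close>. The tail event contains exactly the right atom.\<close>

lemma two_point_ambiguity_setE:
  assumes "P \<in> two_point_ambiguity_set m s f a"
    and f: "f \<in> borel_measurable borel"
  obtains b where "a < m" "m < b" "chord_value f m a b = s"
    "\<And>t. a < t \<Longrightarrow> t \<le> b \<Longrightarrow> measure P {t..} = (m - a) / (b - a)"
proof -
  obtain b w\<^sub>1 w\<^sub>2 where P: "two_point_distribution m a b w\<^sub>1 w\<^sub>2 P"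
    and amb: "has_bochner_integral P (\<lambda>x. x) m" "has_bochner_integral P f s"
    using assms(1) by (auto simp: two_point_ambiguity_set_def ambiguity_set_def)
  have ord: "a < m" "m < b" and w1: "w\<^sub>1 = 1 - w\<^sub>2"
    using P by (auto simp: two_point_distribution_def)
  have "m = w\<^sub>1 * a + w\<^sub>2 * b"
    using has_bochner_integral_integral_eq[OF amb(1)]
      two_point_distribution_integral[OF P, of "\<lambda>x. x"] by simp
  then have "w\<^sub>2 * (b - a) = m - a" by (simp add: w1 algebra_simps)
  then have w2: "w\<^sub>2 = (m - a) / (b - a)" using ord by (simp add: field_simps)
  have w1': "w\<^sub>1 = (b - m) / (b - a)" using ord by (simp add: w1 w2 field_simps)
  have "s = w\<^sub>1 * f a + w\<^sub>2 * f b"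
    using has_bochner_integral_integral_eq[OF amb(2)]
      two_point_distribution_integral[OF P f] by simp
  then have "chord_value f m a b = s" by (simp add: chord_value_def w1' w2)
  then show ?thesis
    using that ord two_point_distribution_upper_tail[OF P] w2 by blast
qed

lemma two_point_ambiguity_set_nonempty:
  assumes "a < m" and "m < b" and "chord_value f m a b = s"
    and f: "f \<in> borel_measurable borel"
  shows "two_point_ambiguity_set m s f a \<noteq> {}"
proof -
  define p where "p = (m - a) / (b - a)"
  have p: "0 < p" "p < 1" using assms by (auto simp: p_def field_simps)
  have q: "1 - p = (b - m) / (b - a)" using assms by (simp add: p_def field_simps)
  define g where "g c = (if c then b else a)" for c :: bool
  define P where "P = distr (measure_pmf (bernoulli_pmf p)) borel g"
  interpret real_distribution P
    unfolding P_def by (intro prob_space.real_distribution_distr measure_pmf.prob_space_axioms) simp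
  have integral: "has_bochner_integral P h ((1 - p) * h a + p * h b)"
    if "h \<in> borel_measurable borel" for h :: "real \<Rightarrow> real"
  proof -
    have "has_bochner_integral (measure_pmf (bernoulli_pmf p)) (\<lambda>c. h (g c))
        (measure_pmf.expectation (bernoulli_pmf p) (\<lambda>c. h (g c)))"
      by (intro has_bochner_integral_integrable integrable_measure_pmf_finite) simp
    then have "has_bochner_integral P h (measure_pmf.expectation (bernoulli_pmf p) (\<lambda>c. h (g c)))"
      unfolding P_def using that by (intro has_bochner_integral_distr) auto
    also have "measure_pmf.expectation (bernoulli_pmf p) (\<lambda>c. h (g c)) = (1 - p) * h a + p * h b"
      using p by (simp add: g_def)
    finally show ?thesis .
  qed
  have "(1 - p) * a + p * b = m"
  proof -
    have "p * (b - a) = m - a" using assms by (simp add: p_def)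
    then show ?thesis by (simp add: algebra_simps)
  qed
  then have mean: "has_bochner_integral P (\<lambda>x. x) m" using integral[of "\<lambda>x. x"] by simp
  have moment: "has_bochner_integral P f s"
    using integral[OF f] assms(3) unfolding q by (simp add: chord_value_def p_def)
  have "g -` {a} = {False}" "g -` {b} = {True}"
    using assms by (auto simp: g_def split: if_splits)
  then have "measure P {a} = 1 - p" "measure P {b} = p"
    using p by (simp_all add: P_def measure_distr measure_pmf_single)
  then have "two_point_distribution m a b (1 - p) p P"
    using assms p real_distribution_axioms by (simp add: two_point_distribution_def)
  then have "P \<in> two_point_ambiguity_set m s f a"
    using mean moment real_distribution_axioms
    by (auto simp: two_point_ambiguity_set_def ambiguity_set_def)
  then show ?thesis by auto
qed

section \<open>The lower bound by duality\<close>

text \<open>Weak duality with the minorant \<open>1 - gap x / gap t\<close> of the indicator, where \<open>gap\<close> is the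
  height of \<open>f\<close> over its tangent at \<open>b\<close>. The tangent point is \<open>b\<close> because a minorant that
  certifies the optimal value has to touch the indicator at the right atom of the extremal
  law, and the scaling puts its zero at the left atom \<open>t\<close>.\<close>

lemma ambiguity_set_upper_tail_ge:
  assumes f: "strictly_convex_on UNIV f" and d: "(f has_real_derivative d) (at b)"
    and "t < m" and "m < b" and s: "chord_value f m t b = s"
    and P: "P \<in> ambiguity_set m s f"
  shows "(m - t) / (b - t) \<le> measure P {t..}"
proof -
  interpret real_distribution P using P by (simp add: ambiguity_set_def)
  have amb: "has_bochner_integral P (\<lambda>x. x) m" "has_bochner_integral P f s"
    using P by (auto simp: ambiguity_set_def)
  define gap where "gap x = f x - f b - d * (x - b)" for x
  have gap_b: "gap b = 0" by (simp add: gap_def)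
  have gap_nonneg: "gap x \<ge> 0" for x
    using strictly_convex_on_above_tangent[OF f d, of x] by (cases "x = b") (auto simp: gap_def)
  have gap_t: "gap t > 0"
    using strictly_convex_on_above_tangent[OF f d, of t] assms(3,4) by (simp add: gap_def)
  \<comment> \<open>Convexity of \<open>gap\<close> together with its minimum at \<open>b\<close>: it decreases to the left of \<open>b\<close>.\<close>
  have gap_left: "gap x \<ge> gap t" if "x < t" for x
  proof -
    have "(b - x) * f t \<le> (b - t) * f x + (t - x) * f b"
      using strictly_convex_onD_three_points[OF f that, of b] assms(3,4) by simp
    then have "(b - x) * gap t \<le> (b - t) * gap x"
      by (simp add: gap_def algebra_simps)
    also have "\<dots> \<le> (b - x) * gap x"
      using that gap_nonneg[of x] by (intro mult_right_mono) auto
    finally show ?thesis using that assms(3,4) by simp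
  qed
  have minorant: "1 - gap x / gap t \<le> indicator {t..} x" for x
    using gap_left[of x] gap_nonneg[of x] gap_t
    by (cases "x < t") (auto simp: field_simps)
  have int_gap: "has_bochner_integral P gap (s - f b - d * (m - b))"
    unfolding gap_def
    by (intro has_bochner_integral_diff has_bochner_integral_mult_right amb)
      (use prob_space in \<open>auto simp: has_bochner_integral_iff\<close>)
  have int: "has_bochner_integral P (\<lambda>x. 1 - gap x / gap t) (1 - (s - f b - d * (m - b)) / gap t)"
    by (intro has_bochner_integral_diff has_bochner_integral_divide_zero int_gap)
      (use prob_space in \<open>auto simp: has_bochner_integral_iff\<close>)
  \<comment> \<open>The expectation of \<open>gap\<close> depends on \<open>m\<close> and \<open>s\<close> alone, so it may be computed from the law
    with masses \<open>1 - p\<close> at \<open>t\<close> and \<open>p\<close> at \<open>b\<close>.\<close>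
  define p where "p = (m - t) / (b - t)"
  have q: "(b - m) / (b - t) = 1 - p" using assms(3,4) by (simp add: p_def field_simps)
  have "p * (b - t) = m - t" using assms(3,4) by (simp add: p_def)
  then have m: "m = (1 - p) * t + p * b" by (simp add: algebra_simps)
  have s': "s = (1 - p) * f t + p * f b"
    using s unfolding chord_value_def q by (simp add: p_def)
  have "s - f b - d * (m - b) = (1 - p) * gap t"
    unfolding s' m gap_def by (simp add: algebra_simps)
  then have "p = 1 - (s - f b - d * (m - b)) / gap t" using gap_t by simp
  also have "\<dots> = (\<integral>x. 1 - gap x / gap t \<partial>P)"
    using has_bochner_integral_integral_eq[OF int] by simp
  also have "\<dots> \<le> (\<integral>x. indicator {t..} x \<partial>P)"
    using minorant int
    by (intro integral_mono) (auto simp: has_bochner_integral_iff emeasure_eq_measure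
        intro!: integrable_real_indicator)
  also have "\<dots> = measure P {t..}" by simp
  finally show ?thesis by (simp add: p_def)
qed

section \<open>Approaching the bound\<close>

text \<open>From below the tail is controlled by duality. From above it suffices that the right atom
  \<open>b'\<close> eventually exceeds any given \<open>c < b\<close>: the chord from \<open>t\<close> to \<open>c\<close> is lower than \<open>s\<close> at
  \<open>m\<close>, by continuity so is the chord from \<open>a\<close> to \<open>c\<close> for \<open>a\<close> near \<open>t\<close>, and then
  monotonicity in the right end point puts \<open>b'\<close> beyond \<open>c\<close>.\<close>

lemma two_point_upper_tail_tendsto:
  assumes f: "strictly_convex_on UNIV f" and d: "(f has_real_derivative d) (at b)"
    and "t < m" and "m < b" and s: "chord_value f m t b = s"
    and Q: "\<forall>\<^sub>F a in at_left t. Q a \<in> two_point_ambiguity_set m s f a"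
  shows "((\<lambda>a. measure (Q a) {t..}) \<longlongrightarrow> (m - t) / (b - t)) (at_left t)"
proof (rule order_tendstoI)
  fix l assume l: "l < (m - t) / (b - t)"
  show "\<forall>\<^sub>F a in at_left t. l < measure (Q a) {t..}"
    using Q
  proof eventually_elim
    case (elim a)
    then have "Q a \<in> ambiguity_set m s f" by (simp add: two_point_ambiguity_set_def)
    from ambiguity_set_upper_tail_ge[OF f d assms(3,4) s this] l show ?case by simp
  qed
next
  fix u assume u: "(m - t) / (b - t) < u"
  have cont: "continuous_on UNIV f" by (rule strictly_convex_on_continuous[OF f])
  then have meas: "f \<in> borel_measurable borel" by (rule borel_measurable_continuous_onI)
  \<comment> \<open>Choose \<open>c < b\<close> so close to \<open>b\<close> that right atoms beyond \<open>c\<close> still give tails below \<open>u\<close>.\<close>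
  have "((\<lambda>c. (m - t) / (c - t)) \<longlongrightarrow> (m - t) / (b - t)) (at_left b)"
    using assms(3,4) by (intro tendsto_intros) auto
  then have "\<forall>\<^sub>F c in at_left b. (m - t) / (c - t) < u" using u by (rule order_tendstoD)
  moreover have "\<forall>\<^sub>F c in at_left b. c \<in> {m<..<b}"
    using assms(4) by (intro eventually_at_left_real)
  ultimately have "\<forall>\<^sub>F c in at_left b. (m - t) / (c - t) < u \<and> c \<in> {m<..<b}"
    by eventually_elim auto
  then obtain c where c: "(m - t) / (c - t) < u" "m < c" "c < b"
    using eventually_happens'[OF trivial_limit_at_left_real] by fastforce
  have "((\<lambda>a. chord_value f m a c) \<longlongrightarrow> chord_value f m t c) (at_left t)"
    unfolding chord_value_def using assms(3) c cont
    by (intro tendsto_intros) (auto simp: continuous_on_def intro: tendsto_mono[OF at_le])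
  moreover have "chord_value f m t c < s"
    using chord_value_strict_mono[OF f assms(3), of c b] c s by simp
  ultimately have "\<forall>\<^sub>F a in at_left t. chord_value f m a c < s" by (rule order_tendstoD)
  moreover have "((\<lambda>a. (m - a) / (c - a)) \<longlongrightarrow> (m - t) / (c - t)) (at_left t)"
    using assms(3) c by (intro tendsto_intros) auto
  then have "\<forall>\<^sub>F a in at_left t. (m - a) / (c - a) < u" using c(1) by (rule order_tendstoD)
  moreover have "\<forall>\<^sub>F a in at_left t. a < t" by (simp add: eventually_at_filter)
  ultimately show "\<forall>\<^sub>F a in at_left t. measure (Q a) {t..} < u"
    using Q
  proof eventually_elim
    case (elim a)
    obtain b' where b': "a < m" "m < b'" "chord_value f m a b' = s"
      and tail: "\<And>t. a < t \<Longrightarrow> t \<le> b' \<Longrightarrow> measure (Q a) {t..} = (m - a) / (b' - a)"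
      using two_point_ambiguity_setE[OF elim(4) meas] by metis
    have "c < b'"
      using chord_value_less_iff[OF f b'(1), of c b'] elim(1) b' c by simp
    then have "(m - a) / (b' - a) \<le> (m - a) / (c - a)"
      using b' c by (intro divide_left_mono) auto
    then show ?case using elim tail[of t] b' assms(3) by simp
  qed
qed

theorem theorem3p3:
  fixes \<mu> s t :: real and \<phi> :: "real \<Rightarrow> real"
  assumes "\<mu> > 0" and "s > 0"
    and "strictly_convex_on UNIV \<phi>"
    and "\<And>x. x \<noteq> \<mu> \<Longrightarrow> \<phi> differentiable (at x)"
    and "filterlim (\<lambda>x. \<bar>\<phi> x / x\<bar>) at_top at_infinity"
    and "\<phi> \<mu> = 0"
    and "\<And>x. \<phi> \<mu> \<le> \<phi> x"
    and "t < \<mu>"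
  shows "(\<exists>!v\<^sub>2. v\<^sub>2 > \<mu> \<and>
           (v\<^sub>2 - \<mu>) / (v\<^sub>2 - t) * \<phi> t + (\<mu> - t) / (v\<^sub>2 - t) * \<phi> v\<^sub>2 = s) \<and>
         (\<forall>v\<^sub>2. v\<^sub>2 > \<mu> \<and>
           (v\<^sub>2 - \<mu>) / (v\<^sub>2 - t) * \<phi> t + (\<mu> - t) / (v\<^sub>2 - t) * \<phi> v\<^sub>2 = s \<longrightarrow>
         (INF P\<in>ambiguity_set \<mu> s \<phi>. measure P {t..}) = (\<mu> - t) / (v\<^sub>2 - t) \<and>
         (\<forall>Q. (\<forall>\<^sub>F v\<^sub>1 in at_left t. Q v\<^sub>1 \<in> two_point_ambiguity_set \<mu> s \<phi> v\<^sub>1) \<longrightarrow>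
            ((\<lambda>v\<^sub>1. measure (Q v\<^sub>1) {t..}) \<longlongrightarrow> (\<mu> - t) / (v\<^sub>2 - t)) (at_left t))) \<and>
         (\<forall>v\<^sub>1<t. two_point_ambiguity_set \<mu> s \<phi> v\<^sub>1 \<noteq> {})"
proof -
  let ?eq = "\<lambda>v\<^sub>2. (v\<^sub>2 - \<mu>) / (v\<^sub>2 - t) * \<phi> t + (\<mu> - t) / (v\<^sub>2 - t) * \<phi> v\<^sub>2 = s"
  note convex = assms(3)
  have chord: "?eq v \<longleftrightarrow> chord_value \<phi> \<mu> t v = s" for v by (simp add: chord_value_def)
  have nonneg: "0 \<le> \<phi> x" for x using assms(6) assms(7)[of x] by simp
  have meas: "\<phi> \<in> borel_measurable borel"
    using strictly_convex_on_continuous[OF convex] by (rule borel_measurable_continuous_onI)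
  have partner: "\<exists>b>\<mu>. chord_value \<phi> \<mu> a b = s" if "a < \<mu>" for a
    using chord_value_attains[OF convex assms(5,6) nonneg that assms(2)] by metis
  have nonempty: "two_point_ambiguity_set \<mu> s \<phi> a \<noteq> {}" if "a < \<mu>" for a
    using partner[OF that] two_point_ambiguity_set_nonempty[OF that _ _ meas] by blast
  have unique: "\<exists>!v\<^sub>2. v\<^sub>2 > \<mu> \<and> ?eq v\<^sub>2"
    unfolding chord using partner[OF assms(8)] chord_value_inj[OF convex assms(8)]
    by (metis less_imp_le)
  have main: "(INF P\<in>ambiguity_set \<mu> s \<phi>. measure P {t..}) = (\<mu> - t) / (v - t) \<and>
      (\<forall>Q. (\<forall>\<^sub>F v\<^sub>1 in at_left t. Q v\<^sub>1 \<in> two_point_ambiguity_set \<mu> s \<phi> v\<^sub>1) \<longrightarrow>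
        ((\<lambda>v\<^sub>1. measure (Q v\<^sub>1) {t..}) \<longlongrightarrow> (\<mu> - t) / (v - t)) (at_left t))"
    if "\<mu> < v" and "?eq v" for v
  proof -
    have s: "chord_value \<phi> \<mu> t v = s" using that chord by simp
    obtain d where d: "(\<phi> has_real_derivative d) (at v)"
      using assms(4)[of v] \<open>\<mu> < v\<close> by (auto simp: real_differentiable_def)
    note bound = ambiguity_set_upper_tail_ge[OF convex d assms(8) that(1) s]
    note limit = two_point_upper_tail_tendsto[OF convex d assms(8) that(1) s]
    define Q where "Q a = (SOME P. P \<in> two_point_ambiguity_set \<mu> s \<phi> a)" for a
    have Q: "Q a \<in> two_point_ambiguity_set \<mu> s \<phi> a" if "a < \<mu>" for a
      unfolding Q_def using nonempty[OF that] by (simp add: some_in_eq)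
    have ev: "\<forall>\<^sub>F a in at_left t. a < \<mu>"
      using assms(8) by (auto simp: eventually_at_filter)
    have Q_lim: "((\<lambda>a. measure (Q a) {t..}) \<longlongrightarrow> (\<mu> - t) / (v - t)) (at_left t)"
      by (rule limit) (use ev Q in \<open>auto elim: eventually_mono\<close>)
    have sub: "two_point_ambiguity_set \<mu> s \<phi> a \<subseteq> ambiguity_set \<mu> s \<phi>" for a
      by (auto simp: two_point_ambiguity_set_def)
    have "(INF P\<in>ambiguity_set \<mu> s \<phi>. measure P {t..}) \<le> measure (Q a) {t..}" if "a < \<mu>" for a
      using Q[OF that] sub[of a] by (intro cINF_lower bdd_belowI2[of _ 0]) auto
    then have "\<forall>\<^sub>F a in at_left t.
        (INF P\<in>ambiguity_set \<mu> s \<phi>. measure P {t..}) \<le> measure (Q a) {t..}"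
      using ev by (auto elim: eventually_mono)
    then have "(INF P\<in>ambiguity_set \<mu> s \<phi>. measure P {t..}) \<le> (\<mu> - t) / (v - t)"
      using tendsto_lowerbound[OF Q_lim] trivial_limit_at_left_real by blast
    moreover have "(\<mu> - t) / (v - t) \<le> (INF P\<in>ambiguity_set \<mu> s \<phi>. measure P {t..})"
      using nonempty[OF assms(8)] sub[of t] bound by (intro cINF_greatest) auto
    ultimately show ?thesis using limit by auto
  qed
  show ?thesis using unique main nonempty assms(8) by simp
qed

end
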